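(* For every fixed cycle $\mathbf{C}$ of the compressor, every element of $\mathbf{C}$ is a BURD rotor type.
   Context: A two-state rotor type is an infinite periodic sequence $r=(r^{(1)},r^{(2)},\dots)$ over two states with fundamental period $|r|$; rotor types are considered up to equivalence (injective relabeling of states), and each is represented over $\{1,2\}$ with $r^{(1)}=1$. $r$ is balanced if its two states occur equally often in a period. A run is a contiguous block of consecutive positions; it is balanced if it contains equally many $1$'s and $2$'s, uniform if all its terms are equal. A balanced run decomposition (BRD) of a balanced $r$ is a partition of the period of $r$ into contiguous balanced runs; its type is the infinite periodic sequence $(b_1,b_2,\dots)$ where $2b_i$ is the length of the $i$-th run, $i$ taken modulo the number of runs. A uniform run decomposition (URD) of $r$ is a partition of the period of $r$ into contiguous uniform runs; its type is the infinite periodic sequence $(u_1,u_2,\dots)$ of run lengths, $i$ taken modulo the number of runs. A BURD rotor type is a balanced rotor type having a BRD and a URD of the same type. Rotor-router dynamics: at each non-target vertex $v$ there is a periodic sequence $e_v^{(1)},e_v^{(2)},\dots$ of out-edges; a particle starts at the source, on its $j$-th visit to $v$ leaves along $e_v^{(j)}$, and whenever it reaches a target it is returned to the source; the hitting sequence is the (periodic) sequence of targets reached. The compressor for $r$ has non-target vertices $1$ (source), $2,3$ and targets $4,5$. On the $j$-th departure: from vertex $1$ the particle goes to vertex $2$ if $r^{(j)}=1$ and to vertex $3$ if $r^{(j)}=2$; from vertex $2$, in variant $U$ it goes to vertex $1$ if $r^{(j)}=1$ and to target $4$ if $r^{(j)}=2$, in variant $D$ to target $4$ if $r^{(j)}=1$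 and to vertex $1$ if $r^{(j)}=2$; from vertex $3$ likewise with target $5$. For $X,Y\in\{U,D\}$ the compressor operation $XY$ sends $r$ to the hitting sequence with variant $X$ at vertex $2$ and $Y$ at vertex $3$, viewed as a rotor type. A fixed cycle of the compressor is a set $\mathbf{C}$ of rotor types, closed under the four operations $UU,UD,DU,DD$, such that any element of $\mathbf{C}$ can be reached from any other element by some finite sequence of compressor operations. *)

theory Defs
  imports Main "HOL-Library.Infinite_Set"
begin

text \<open>
  Infinite sequences are functions on \<open>nat\<close>, counted from 0: the term \<open>r\<^sup>(\<^sup>j\<^sup>)\<close> of a
  sequence indexed from 1 is \<open>r (j - 1)\<close>.
\<close>

section \<open>Two-state rotor types\<close>

definition periodic_seq :: "(nat \<Rightarrow> 'a) \<Rightarrow> bool" where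
  "periodic_seq r \<longleftrightarrow> (\<exists>p>0. \<forall>i. r (i + p) = r i)"

definition fund_period :: "(nat \<Rightarrow> 'a) \<Rightarrow> nat" where
  "fund_period r = (LEAST p. p > 0 \<and> (\<forall>i. r (i + p) = r i))"

text \<open>
  Rotor types are identified with their representatives over \<open>{1, 2}\<close> whose first term is 1.
  Both states have to occur: for a constant sequence the compressor may never reach a target.
\<close>

definition rotor_type :: "(nat \<Rightarrow> nat) \<Rightarrow> bool" where
  "rotor_type r \<longleftrightarrow> range r = {1, 2} \<and> r 0 = 1 \<and> periodic_seq r"

text \<open>The representative of a sequence over two arbitrary states, up to relabeling of the states.\<close>

definition as_rotor_type :: "(nat \<Rightarrow> 'a) \<Rightarrow> nat \<Rightarrow> nat" where
  "as_rotor_type h = (\<lambda>i. if h i = h 0 then 1 else 2)"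

definition balanced_rotor :: "(nat \<Rightarrow> nat) \<Rightarrow> bool" where
  "balanced_rotor r \<longleftrightarrow>
     card {i. i < fund_period r \<and> r i = 1} = card {i. i < fund_period r \<and> r i = 2}"

section \<open>Run decompositions\<close>

definition balanced_run :: "nat list \<Rightarrow> bool" where
  "balanced_run w \<longleftrightarrow> count_list w 1 = count_list w 2"

definition uniform_run :: "nat list \<Rightarrow> bool" where
  "uniform_run w \<longleftrightarrow> (\<forall>x\<in>set w. \<forall>y\<in>set w. x = y)"

text \<open>
  A partition of the period \<open>r\<^sup>(\<^sup>1\<^sup>), \<dots>, r\<^sup>(\<^sup>|\<^sup>r\<^sup>|\<^sup>)\<close> into contiguous runs is a factorization of this
  word into nonempty words, listed in order. Uniform runs need not be maximal.
\<close>

definition run_decomposition :: "(nat \<Rightarrow> nat) \<Rightarrow> nat list list \<Rightarrow> bool" where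
  "run_decomposition r ws \<longleftrightarrow> concat ws = map r [0..<fund_period r] \<and> [] \<notin> set ws"

definition BRD :: "(nat \<Rightarrow> nat) \<Rightarrow> nat list list \<Rightarrow> bool" where
  "BRD r ws \<longleftrightarrow> balanced_rotor r \<and> run_decomposition r ws \<and> (\<forall>w\<in>set ws. balanced_run w)"

definition URD :: "(nat \<Rightarrow> nat) \<Rightarrow> nat list list \<Rightarrow> bool" where
  "URD r ws \<longleftrightarrow> run_decomposition r ws \<and> (\<forall>w\<in>set ws. uniform_run w)"

text \<open>Balanced runs over \<open>{1, 2}\<close> have even length, so the division by 2 is exact.\<close>

definition BRD_type :: "nat list list \<Rightarrow> nat \<Rightarrow> nat" where
  "BRD_type ws = (\<lambda>i. length (ws ! (i mod length ws)) div 2)"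

definition URD_type :: "nat list list \<Rightarrow> nat \<Rightarrow> nat" where
  "URD_type ws = (\<lambda>i. length (ws ! (i mod length ws)))"

definition BURD :: "(nat \<Rightarrow> nat) \<Rightarrow> bool" where
  "BURD r \<longleftrightarrow> rotor_type r \<and> balanced_rotor r \<and>
     (\<exists>bs us. BRD r bs \<and> URD r us \<and> BRD_type bs = URD_type us)"

section \<open>Rotor-router dynamics\<close>

text \<open>
  A configuration consists of the position of the particle and, for each vertex, the number of
  departures made from it so far. As there are no parallel edges, an out-edge is given by its
  end point: \<open>e v j\<close> is where the particle goes on departure number \<open>j + 1\<close> from \<open>v\<close>.
\<close>

definition rr_step ::
  "'v \<Rightarrow> 'v set \<Rightarrow> ('v \<Rightarrow> nat \<Rightarrow> 'v) \<Rightarrow> 'v \<times> ('v \<Rightarrow> nat) \<Rightarrow> 'v \<times> ('v \<Rightarrow> nat)" where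
  "rr_step s T e = (\<lambda>(v, c). if v \<in> T then (s, c) else (e v (c v), c(v := Suc (c v))))"

definition rr_position :: "'v \<Rightarrow> 'v set \<Rightarrow> ('v \<Rightarrow> nat \<Rightarrow> 'v) \<Rightarrow> nat \<Rightarrow> 'v" where
  "rr_position s T e t = fst ((rr_step s T e ^^ t) (s, \<lambda>_. 0))"

text \<open>Meaningful only if targets are reached infinitely often.\<close>

definition hitting_sequence :: "'v \<Rightarrow> 'v set \<Rightarrow> ('v \<Rightarrow> nat \<Rightarrow> 'v) \<Rightarrow> nat \<Rightarrow> 'v" where
  "hitting_sequence s T e n = rr_position s T e (enumerate {t. rr_position s T e t \<in> T} n)"

section \<open>The compressor\<close>

datatype variant = U | D

fun out_vertex :: "variant \<Rightarrow> nat \<Rightarrow> nat \<Rightarrow> nat" where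
  "out_vertex U target x = (if x = 1 then 1 else target)"
| "out_vertex D target x = (if x = 1 then target else 1)"

definition compressor_edges :: "variant \<Rightarrow> variant \<Rightarrow> (nat \<Rightarrow> nat) \<Rightarrow> nat \<Rightarrow> nat \<Rightarrow> nat" where
  "compressor_edges X Y r v j =
     (if v = 1 then (if r j = 1 then 2 else 3)
      else if v = 2 then out_vertex X 4 (r j)
      else out_vertex Y 5 (r j))"

definition compress :: "variant \<Rightarrow> variant \<Rightarrow> (nat \<Rightarrow> nat) \<Rightarrow> nat \<Rightarrow> nat" where
  "compress X Y r = as_rotor_type (hitting_sequence 1 {4, 5} (compressor_edges X Y r))"

definition compress_step :: "(nat \<Rightarrow> nat) \<Rightarrow> (nat \<Rightarrow> nat) \<Rightarrow> bool" where
  "compress_step r r' \<longleftrightarrow> (\<exists>X Y. r' = compress X Y r)"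

definition fixed_cycle :: "(nat \<Rightarrow> nat) set \<Rightarrow> bool" where
  "fixed_cycle C \<longleftrightarrow>
     (\<forall>r\<in>C. rotor_type r) \<and>
     (\<forall>r\<in>C. \<forall>X Y. compress X Y r \<in> C) \<and>
     (\<forall>r\<in>C. \<forall>r'\<in>C. r \<noteq> r' \<longrightarrow> compress_step\<^sup>*\<^sup>* r r')"

end

theory Submission
  imports Defs
begin

text \<open>
  The operation \<open>XY\<close> keeps the \<open>i\<close>-th occurrence of a state \<open>a\<close> iff the \<open>i\<close>-th term of \<open>r\<close> is the
  one selected by \<open>X\<close> (for \<open>a = 1\<close>) or \<open>Y\<close> (for \<open>a = 2\<close>). Applying \<open>UD\<close> makes \<open>r\<close> balanced, balance is
  preserved, and on balanced types no operation increases the fundamental period; so in a fixed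
  cycle all types are balanced with the same period \<open>2k\<close>. Count the \<open>c \<le> k\<close> for which the prefix of
  length \<open>2c\<close> is balanced. The pairs formed by the \<open>i\<close>-th 1 and the \<open>i\<close>-th 2 with label \<open>r\<^sup>(\<^sup>i\<^sup>)\<close> go to
  \<open>UU\<close> or to \<open>DD\<close> according to that label, and each block between consecutive balanced prefixes
  yields a block in at least one of the two, in both if its labels are not all equal. So an
  element with the maximal count has uniform labels on each block, which is the BURD property,
  and \<open>UU\<close> and \<open>DD\<close> both keep the count maximal. As \<open>UD\<close> and \<open>DU\<close> fix BURD types, the elements
  with maximal count are closed under all operations, hence form the whole cycle.
\<close>

section \<open>Counting occurrences\<close>

text \<open>Besides a prefix count this is a rank: if \<open>r j = a\<close>, position
  \<open>j\<close> holds the occurrence of \<open>a\<close> with 0-based index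
  \<open>occ r a j\<close>. With a predicate for \<open>r\<close> and \<open>True\<close> for
  \<open>a\<close> it counts the positions satisfying the predicate.\<close>

definition occ :: "(nat \<Rightarrow> 'a) \<Rightarrow> 'a \<Rightarrow> nat \<Rightarrow> nat" where
  "occ r a n = card {i. i < n \<and> r i = a}"

lemma occ_0 [simp]: "occ r a 0 = 0"
  by (simp add: occ_def)

lemma occ_Suc [simp]: "occ r a (Suc n) = occ r a n + (if r n = a then 1 else 0)"
proof -
  have "{i. i < Suc n \<and> r i = a} = (if r n = a then insert n else id) {i. i < n \<and> r i = a}"
    by (auto simp: less_Suc_eq)
  then show ?thesis by (simp add: occ_def)
qed

lemma occ_mono: "m \<le> n \<Longrightarrow> occ r a m \<le> occ r a n"
  by (auto simp: occ_def intro!: card_mono)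

lemma occ_add_period:
  assumes "\<forall>i. r (i + p) = r i"
  shows "occ r a (n + p) = occ r a n + occ r a p"
  using assms by (induction n) auto

lemma occ_mult_period:
  assumes "\<forall>i. r (i + p) = r i"
  shows "occ r a (m * p) = m * occ r a p"
  by (induction m) (simp_all add: occ_add_period[OF assms] add.commute[of p])

lemma occ_total: "range r \<subseteq> {1, 2} \<Longrightarrow> occ r 1 n + occ r (2 :: nat) n = n"
proof (induction n)
  case (Suc n)
  moreover have "r n = 1 \<or> r n = 2" using Suc.prems by auto
  ultimately show ?case by auto
qed simp

lemma occ_add_const:
  assumes "\<And>i. m \<le> i \<Longrightarrow> i < m + d \<Longrightarrow> r i = b"
  shows "occ r a (m + d) = occ r a m + (if b = a then d else 0)"
  using assms by (induction d) auto

lemma occ_add_full: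
  "occ r a (m + d) = occ r a m + d \<Longrightarrow> (\<forall>i<d. r (m + i) = a)"
proof (induction d)
  case (Suc d)
  have "occ r a (m + d) \<le> occ r a m + d" by (induction d) auto
  with Suc show ?case by (auto simp: less_Suc_eq split: if_splits)
qed simp

lemma period_mult: "(\<forall>i. r (i + p) = r i) \<Longrightarrow> r (i + m * p) = r (i :: nat)"
  by (induction m arbitrary: i) (simp_all, metis add.assoc add.commute)

section \<open>Filtering a two-state sequence\<close>

text \<open>At departure \<open>j\<close> from the source the particle enters the vertex of state
  \<open>r j\<close> with 0-based visit number \<open>occ r (r j) j\<close>. \<open>K\<close> names,
  for each state, the rotor value that sends the particle on to a target.\<close>

definition kept :: "(nat \<Rightarrow> nat) \<Rightarrow> (nat \<Rightarrow> nat) \<Rightarrow> nat \<Rightarrow> bool" where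
  "kept K r j \<longleftrightarrow> r (occ r (r j) j) = K (r j)"

definition sel :: "(nat \<Rightarrow> nat) \<Rightarrow> (nat \<Rightarrow> nat) \<Rightarrow> nat \<Rightarrow> nat" where
  "sel K r n = r (enumerate {j. kept K r j} n)"

abbreviation kept_count :: "(nat \<Rightarrow> nat) \<Rightarrow> (nat \<Rightarrow> nat) \<Rightarrow> nat \<Rightarrow> nat" where
  "kept_count K r \<equiv> occ (kept K r) True"

section \<open>Enumerations of infinite sets of natural numbers\<close>

lemma strict_mono_range_unique:
  fixes f g :: "nat \<Rightarrow> 'a :: linorder"
  assumes "strict_mono f" "strict_mono g" "range f = range g"
  shows "f = g"
proof
  fix n
  show "f n = g n"
  proof (induction n rule: less_induct)
    case (less n)
    have *: "f' n \<le> g' n" if mono: "strict_mono f'" "strict_mono g'"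
      and range: "range f' = range g'" and eq: "\<And>m. m < n \<Longrightarrow> f' m = g' m" for f' g' :: "nat \<Rightarrow> 'a"
    proof -
      obtain m where m: "g' n = f' m" using range by (metis rangeE rangeI)
      have "\<not> m < n"
        using m eq[of m] strict_mono_eq[OF mono(2), of m n] by auto
      then show ?thesis using m strict_mono_less_eq[OF mono(1), of n m] by simp
    qed
    show ?case by (rule antisym) (use * assms less in \<open>metis\<close>)+
  qed
qed

text \<open>Both sides enumerate the same set increasingly, and such an enumeration is
  unique.\<close>

lemma enumerate_image:
  fixes f :: "nat \<Rightarrow> nat"
  assumes "strict_mono f" "infinite A"
  shows "enumerate (f ` A) n = f (enumerate A n)"
proof -
  have inf: "infinite (f ` A)"
    using assms by (simp add: finite_image_iff strict_mono_imp_inj_on)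
  have r: "range (enumerate S) = S" if "infinite S" for S :: "nat set"
    using bij_enumerate[OF that] by (simp add: bij_betw_def)
  have sm: "strict_mono (enumerate S)" if "infinite S" for S :: "nat set"
    using that by (simp add: strict_mono_def)
  have "enumerate (f ` A) = f \<circ> enumerate A"
  proof (rule strict_mono_range_unique)
    show "strict_mono (f \<circ> enumerate A)"
      using assms by (simp add: strict_mono_def)
    show "range (enumerate (f ` A)) = range (f \<circ> enumerate A)"
      using r[OF inf] r[OF assms(2)] by (metis image_comp)
  qed (rule sm[OF inf])
  then show ?thesis by simp
qed

lemma occ_enumerate:
  assumes "infinite {j. P j}"
  shows "occ P True (enumerate {j. P j} n) = n"
proof -
  let ?e = "enumerate {j. P j}"
  have "{i. i < ?e n \<and> P i = True} = ?e ` {..<n}"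
    using assms enumerate_in_set[OF assms] enumerate_Ex[OF assms] by fastforce
  then show ?thesis
    using inj_enumerate[OF assms] by (simp add: occ_def card_image inj_on_subset)
qed

lemma enumerate_occ:
  assumes "infinite {j. P j}" "P j"
  shows "enumerate {j. P j} (occ P True j) = j"
  using occ_enumerate[OF assms(1)] enumerate_Ex[OF assms(1)] assms(2) by (metis mem_Collect_eq)

lemma sel_kept_count:
  assumes "infinite {j. kept K r j}" "kept K r j"
  shows "sel K r (kept_count K r j) = r j"
  by (simp add: sel_def enumerate_occ[OF assms])

text \<open>Survival of an occurrence of \<open>a\<close> depends only on its rank \<open>i\<close>,
  through the test \<open>r i = K a\<close>; so \<open>occ r (K a)\<close> counts the survivors
  among the first \<open>occ r a j\<close> occurrences.\<close>

lemma occ_kept: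
  assumes inf: "infinite {j. kept K r j}"
  shows "occ (sel K r) a (kept_count K r j) = occ r (K a) (occ r a j)"
proof (induction j)
  case (Suc j)
  show ?case
  proof (cases "kept K r j")
    case True
    with Suc show ?thesis
      using sel_kept_count[OF inf True] True[unfolded kept_def] by auto
  next
    case False
    with Suc show ?thesis by (auto simp: kept_def)
  qed
qed simp

text \<open>After \<open>L\<close> departures from the source all three rotors are back in their initial position.\<close>

locale rotor_cycle =
  fixes r :: "nat \<Rightarrow> nat" and n L :: nat
  assumes two: "range r \<subseteq> {1, 2}"
    and per: "\<forall>i. r (i + n) = r i"
    and dvdL: "n dvd L" "n dvd occ r 1 L" "n dvd occ r 2 L"
begin

text \<open>A shift by \<open>L\<close> advances each rank by a multiple of \<open>n\<close>, so
  every rotor reads the same value again.\<close>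

lemma kept_period: "\<forall>j. kept K r (j + L) = kept K r j"
proof
  fix j
  have "r j \<in> {1, 2}" using two by auto
  moreover have rn: "r (i + m) = r i" if "n dvd m" for i m
    using that period_mult[OF per] by (auto simp: dvd_def mult.commute)
  moreover have "occ r a (j + L) = occ r a j + occ r a L" for a
    by (rule occ_add_period) (use rn dvdL in auto)
  ultimately show "kept K r (j + L) = kept K r j"
    unfolding kept_def using dvdL by auto
qed

lemma kept_count_eq:
  "kept_count K r j = occ r (K 1) (occ r 1 j) + occ r (K 2) (occ r 2 j)"
proof (induction j)
  case (Suc j)
  have "r j \<in> {1, 2}" using two by auto
  with Suc show ?case by (auto simp: kept_def)
qed simp

lemma infinite_kept:
  assumes "kept_count K r L > 0"
  shows "infinite {j. kept K r j}"
proof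
  assume fin: "finite {j. kept K r j}"
  \<comment> \<open>One more cycle than there are kept positions, while each cycle contributes at
    least one.\<close>
  define m where "m = Suc (card {j. kept K r j})"
  have "m \<le> m * kept_count K r L" using assms by simp
  also have "\<dots> = kept_count K r (m * L)"
    by (rule occ_mult_period[OF kept_period, symmetric])
  also have "\<dots> \<le> card {j. kept K r j}"
    unfolding occ_def by (rule card_mono[OF fin]) auto
  finally show False by (simp add: m_def)
qed

lemma sel_period:
  assumes "kept_count K r L > 0"
  shows "\<forall>i. sel K r (i + kept_count K r L) = sel K r i"
proof
  fix i
  note inf = infinite_kept[OF assms]
  define j where "j = enumerate {j. kept K r j} i"
  have j: "kept K r j" "kept_count K r j = i"
    using enumerate_in_set[OF inf] occ_enumerate[OF inf] by (auto simp: j_def)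
  have "kept_count K r (j + L) = i + kept_count K r L"
    using occ_add_period[OF kept_period] j by simp
  moreover have "r (j + L) = r j"
    using dvdL(1) period_mult[OF per] by (auto simp: dvd_def mult.commute)
  ultimately show "sel K r (i + kept_count K r L) = sel K r i"
    using sel_kept_count[OF inf j(1)] sel_kept_count[OF inf, of "j + L"] kept_period j by metis
qed

end

lemma range_sel: "range r \<subseteq> A \<Longrightarrow> range (sel K r) \<subseteq> A"
  by (auto simp: sel_def)

section \<open>The compressor as a filter\<close>

text \<open>The rotor value on which a variant exits to its target; the other value leads back to
  the source.\<close>

fun letter :: "variant \<Rightarrow> nat" where
  "letter U = 2"
| "letter D = 1"

definition compressor_keep :: "variant \<Rightarrow> variant \<Rightarrow> nat \<Rightarrow> nat" where
  "compressor_keep X Y a = letter (if a = 1 then X else Y)"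

context
  fixes r :: "nat \<Rightarrow> nat" and X Y :: variant
  assumes two: "range r \<subseteq> {1, 2}"
begin

private abbreviation keep where "keep \<equiv> kept (compressor_keep X Y) r"
private abbreviation step where "step \<equiv> rr_step 1 {4, 5} (compressor_edges X Y r)"
private abbreviation target :: "nat \<Rightarrow> nat" where "target a \<equiv> if a = 1 then 4 else 5"

text \<open>The time of departure \<open>j\<close> from the source. A trip takes two steps if it
  comes straight back, and three if it hits a target, the third being the return from there.\<close>

private fun depart :: "nat \<Rightarrow> nat" where
  "depart 0 = 0"
| "depart (Suc j) = depart j + (if keep j then 3 else 2)"

text \<open>The counters at time \<open>depart j\<close>. They stay 0 at targets because the return
  to the source counts as no departure.\<close>

private definition departures :: "nat \<Rightarrow> nat \<Rightarrow> nat" where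
  "departures j v =
     (if v = 1 then j else if v = 2 then occ r 1 j else if v = 3 then occ r 2 j else 0)"

private lemma round_trip:
  assumes "r j = a"
  shows "fst (step (1, departures j)) \<in> {2, 3}"
    and "step (step (1, departures j)) =
      (if keep j then target a else 1, departures (Suc j))"
proof -
  have a: "a = 1 \<or> a = 2" using two assms by auto
  have b: "r i = 1 \<or> r i = 2" for i using two by auto
  show "fst (step (1, departures j)) \<in> {2, 3}"
    by (simp add: rr_step_def compressor_edges_def)
  show "step (step (1, departures j)) =
      (if keep j then target a else 1, departures (Suc j))"
    using a b[of "occ r a j"] assms
    by (cases X; cases Y)
      (auto simp: rr_step_def compressor_edges_def departures_def kept_def compressor_keep_def
        fun_eq_iff)
qed

private lemma step_depart:
  "(step ^^ depart j) (1, \<lambda>_. 0) = (1, departures j)"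
proof (induction j)
  case 0
  show ?case by (auto simp: departures_def)
next
  case (Suc j)
  have "(step ^^ (depart j + 2)) (1, \<lambda>_. 0) = step (step (1, departures j))"
    using Suc by simp
  then have *: "(step ^^ (depart j + 2)) (1, \<lambda>_. 0) =
      (if keep j then target (r j) else 1, departures (Suc j))"
    using round_trip(2)[OF refl] by metis
  show ?case
  proof (cases "keep j")
    case True
    then have "depart (Suc j) = Suc (depart j + 2)" by simp
    then show ?thesis using * True by (simp del: depart.simps) (simp add: rr_step_def)
  next
    case False
    then show ?thesis using * by simp
  qed
qed

private lemma position:
  "rr_position 1 {4, 5} (compressor_edges X Y r) (depart j) = 1"
  "rr_position 1 {4, 5} (compressor_edges X Y r) (Suc (depart j)) \<in> {2, 3}"
  "rr_position 1 {4, 5} (compressor_edges X Y r) (depart j + 2) =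
     (if keep j then target (r j) else 1)"
  using step_depart[of j] round_trip[of j, OF refl] by (simp_all add: rr_position_def)

text \<open>Offset 2 of trip \<open>j\<close> is a target visit only if \<open>keep j\<close> holds;
  otherwise that time already starts trip \<open>j + 1\<close>.\<close>

private lemma time_cases:
  "\<exists>j. t = depart j \<or> t = Suc (depart j) \<or> keep j \<and> t = depart j + 2"
proof (induction t)
  case 0
  show ?case by (rule exI[of _ 0]) simp
next
  case (Suc t)
  then obtain j where "t = depart j \<or> t = Suc (depart j) \<or> keep j \<and> t = depart j + 2" by blast
  then consider "Suc t = Suc (depart j)" | "keep j" "Suc t = depart j + 2"
    | "Suc t = depart (Suc j)" by fastforce
  then show ?case by cases blast+
qed

private lemma target_times:
  "{t. rr_position 1 {4, 5} (compressor_edges X Y r) t \<in> {4, 5}} =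
     (\<lambda>j. depart j + 2) ` {j. keep j}"
proof (intro set_eqI iffI)
  fix t
  assume t: "t \<in> {t. rr_position 1 {4, 5} (compressor_edges X Y r) t \<in> {4, 5}}"
  obtain j where "t = depart j \<or> t = Suc (depart j) \<or> keep j \<and> t = depart j + 2"
    using time_cases by blast
  then show "t \<in> (\<lambda>j. depart j + 2) ` {j. keep j}"
    using t position[of j] by auto
next
  fix t
  assume "t \<in> (\<lambda>j. depart j + 2) ` {j. keep j}"
  then obtain j where "keep j" "t = depart j + 2" by auto
  then show "t \<in> {t. rr_position 1 {4, 5} (compressor_edges X Y r) t \<in> {4, 5}}"
    by (simp only: mem_Collect_eq position(3)) auto
qed

text \<open>Target visits are the image of the kept indices under an increasing map, so the hit with
  index \<open>n\<close> belongs to the kept index with the same number.\<close>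

lemma hitting_sequence_compressor:
  assumes "infinite {j. kept (compressor_keep X Y) r j}"
  shows "hitting_sequence 1 {4, 5} (compressor_edges X Y r) n =
    (if sel (compressor_keep X Y) r n = 1 then 4 else 5)"
proof -
  have "strict_mono (\<lambda>j. depart j + 2)"
    by (rule strict_mono_Suc_iff[THEN iffD2]) simp
  from enumerate_image[OF this assms] show ?thesis
    unfolding hitting_sequence_def target_times
    using position(3)[of "enumerate {j. keep j} n"] enumerate_in_set[OF assms, of n]
    by (simp add: sel_def)
qed

text \<open>Targets 4 and 5 stand for the states 1 and 2, and \<open>as_rotor_type\<close> sees only
  which terms agree with the first.\<close>

lemma compress_eq:
  assumes "infinite {j. kept (compressor_keep X Y) r j}"
  shows "compress X Y r = as_rotor_type (sel (compressor_keep X Y) r)"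
proof -
  let ?g = "sel (compressor_keep X Y) r"
  have "?g i = 1 \<or> ?g i = 2" for i using range_sel[OF two, of "compressor_keep X Y"] by auto
  then show ?thesis
    unfolding compress_def as_rotor_type_def hitting_sequence_compressor[OF assms] fun_eq_iff
    by (metis numeral_eq_iff semiring_norm(89))
qed

end

section \<open>Balance points\<close>

declare One_nat_def [simp del]

definition balance_points :: "(nat \<Rightarrow> nat) \<Rightarrow> nat set" where
  "balance_points r = {c. occ r 1 (2 * c) = c}"

text \<open>
  The BURD property in terms of prefixes: in a BRD and a URD of the same type, cuts \<open>c\<close> of the URD
  correspond to cuts \<open>2 * c\<close> of the BRD, and changes of state take place only at cuts of the URD.
\<close>

definition cut_compatible :: "(nat \<Rightarrow> nat) \<Rightarrow> bool" where
  "cut_compatible r \<longleftrightarrow> (\<forall>i. r i \<noteq> r (Suc i) \<longrightarrow> Suc i \<in> balance_points r)"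

lemma constant_between_balance_points:
  assumes "cut_compatible r" "\<And>i. c < i \<Longrightarrow> i < c' \<Longrightarrow> i \<notin> balance_points r"
    and "c \<le> i" "i < c'"
  shows "r i = r c"
  using assms(3,4)
proof (induction i rule: dec_induct)
  case (step i)
  then have "Suc i \<notin> balance_points r" using assms(2) by simp
  then have "r i = r (Suc i)" using assms(1) unfolding cut_compatible_def by metis
  with step show ?case by simp
qed simp

lemma as_rotor_type_cases:
  assumes "range g \<subseteq> {1, 2}"
  shows "as_rotor_type g = (if g 0 = 1 then g else (\<lambda>i. 3 - g i))"
proof
  fix i
  have "g i \<in> {1, 2}" "g 0 \<in> {1, 2}" using assms by auto
  then show "as_rotor_type g i = (if g 0 = 1 then g else (\<lambda>i. 3 - g i)) i"
    by (auto simp: as_rotor_type_def)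
qed

lemma occ_flip:
  assumes "range g \<subseteq> {1, 2 :: nat}"
  shows "occ (\<lambda>i. 3 - g i) 1 n = occ g 2 n" "occ (\<lambda>i. 3 - g i) 2 n = occ g 1 n"
proof -
  have "g i = 1 \<or> g i = 2" for i using assms by auto
  then have "3 - g i = 1 \<longleftrightarrow> g i = 2" "3 - g i = 2 \<longleftrightarrow> g i = 1" for i
    by (metis diff_Suc_1 numeral_2_eq_2 numeral_3_eq_3 diff_Suc_Suc one_eq_numeral_iff
        num.distinct(1) One_nat_def)+
  then show "occ (\<lambda>i. 3 - g i) 1 n = occ g 2 n" "occ (\<lambda>i. 3 - g i) 2 n = occ g 1 n"
    unfolding occ_def by simp_all
qed

lemma balance_points_as_rotor_type:
  assumes "range g \<subseteq> {1, 2}"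
  shows "balance_points (as_rotor_type g) = balance_points g"
proof -
  have "occ g 1 (2 * c) + occ g 2 (2 * c) = 2 * c" for c by (rule occ_total[OF assms])
  then have "occ g 2 (2 * c) = c \<longleftrightarrow> occ g 1 (2 * c) = c" for c
    by (metis add_left_imp_eq add_right_imp_eq mult_2)
  then show ?thesis
    by (simp add: as_rotor_type_cases[OF assms] balance_points_def occ_flip[OF assms])
qed

text \<open>\<open>k\<close> is half a period, and that period need not be the least one. This is
  the form in which balance passes to the compressed type with the same \<open>k\<close>.\<close>

definition balanced_period :: "(nat \<Rightarrow> nat) \<Rightarrow> nat \<Rightarrow> bool" where
  "balanced_period r k \<longleftrightarrow>
     k > 0 \<and> (\<forall>i. r (i + 2 * k) = r i) \<and> occ r 1 (2 * k) = k \<and> occ r 2 (2 * k) = k"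

lemma balanced_period_as_rotor_type:
  assumes "range g \<subseteq> {1, 2}" "balanced_period g k"
  shows "balanced_period (as_rotor_type g) k"
  using assms(2) unfolding as_rotor_type_cases[OF assms(1)] balanced_period_def
  by (simp add: occ_flip[OF assms(1)])

lemma fund_period:
  assumes "periodic_seq r"
  shows "fund_period r > 0" "\<forall>i. r (i + fund_period r) = r i"
  using LeastI_ex[OF assms[unfolded periodic_seq_def]] by (simp_all add: fund_period_def)

lemma fund_period_le:
  assumes "p > 0" "\<forall>i. r (i + p) = r i"
  shows "fund_period r \<le> p"
  unfolding fund_period_def by (rule Least_le) (use assms in simp)

lemma fund_period_balanced:
  assumes two: "range r \<subseteq> {1, 2}" and bal: "balanced_period r k"
  obtains m where "fund_period r = 2 * m" "balanced_period r m" "m \<le> k"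
proof -
  let ?n = "fund_period r"
  have k: "k > 0" "\<forall>i. r (i + 2 * k) = r i" "occ r 1 (2 * k) = occ r 2 (2 * k)"
    using bal by (simp_all add: balanced_period_def)
  then have "periodic_seq r" unfolding periodic_seq_def by (intro exI[of _ "2 * k"]) simp
  note n = fund_period[OF this]
  \<comment> \<open>Both sides count \<open>a\<close> in \<open>2 * k * ?n\<close> positions; so
    equal shares of the states pass from the period \<open>2 * k\<close> to the least one.\<close>
  have eq: "2 * k * occ r a ?n = ?n * occ r a (2 * k)" for a
    by (metis mult.commute occ_mult_period[OF n(2)] occ_mult_period[OF k(2)])
  have "2 * k * occ r 1 ?n = 2 * k * occ r 2 ?n" using eq k(3) by metis
  then have same: "occ r 1 ?n = occ r 2 ?n" using k(1) by simp
  moreover have "occ r 1 ?n + occ r 2 ?n = ?n" by (rule occ_total[OF two])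
  ultimately have "?n = 2 * occ r 1 ?n" by simp
  moreover from this have "balanced_period r (occ r 1 ?n)"
    using n same unfolding balanced_period_def by simp
  moreover have "occ r 1 ?n \<le> k"
    using fund_period_le[OF _ k(2)] k(1) calculation(1) by simp
  ultimately show ?thesis by (rule that)
qed

section \<open>Compressing a balanced sequence\<close>

text \<open>\<open>UD\<close> keeps a 1 when the rotor reads 2 and a 2 when it reads 1. In
  \<open>n * n\<close> departures the vertex of state \<open>a\<close> is visited
  \<open>n * occ r a n\<close> times, so each state survives \<open>occ r 1 n * occ r 2 n\<close>
  times.\<close>

lemma compress_U_D_balanced:
  assumes "rotor_type r"
  obtains k where "balanced_period (compress U D r) k"
proof -
  have two: "range r = {1, 2}" and "periodic_seq r" using assms by (simp_all add: rotor_type_def)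
  define n where "n = fund_period r"
  have n: "n > 0" "\<forall>i. r (i + n) = r i"
    unfolding n_def by (rule fund_period[OF \<open>periodic_seq r\<close>])+
  have pos: "occ r a n > 0" if "a \<in> {1, 2}" for a
  proof -
    have "a \<in> range r" using that two by simp
    then obtain i where "r i = a" by auto
    then have "r (i mod n) = a"
      using period_mult[OF n(2), of "i mod n" "i div n"] by (simp add: add.commute)
    then have "i mod n \<in> {i. i < n \<and> r i = a}" using n(1) by simp
    then show ?thesis unfolding occ_def by (subst card_gt_0_iff) auto
  qed
  have L: "occ r a (n * m) = m * occ r a n" for a m
    using occ_mult_period[OF n(2), of a m] by (simp add: mult.commute)
  interpret rotor_cycle r n "n * n"
    by unfold_locales (use two n L in auto)
  let ?K = "compressor_keep U D"
  let ?k = "occ r 1 n * occ r 2 n"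
  have K: "?K 1 = 2" "?K 2 = 1" by (simp_all add: compressor_keep_def)
  have kc: "kept_count ?K r (n * n) = 2 * ?k"
    unfolding kept_count_eq K L by simp
  have "?k > 0" using pos by simp
  with kc have "kept_count ?K r (n * n) > 0" by simp
  note inf = infinite_kept[OF this] and per' = sel_period[OF this]
  have "occ (sel ?K r) 1 (2 * ?k) = ?k" "occ (sel ?K r) 2 (2 * ?k) = ?k"
    using occ_kept[OF inf, of _ "n * n", unfolded kc] K
    by (simp_all add: L)
  then have "balanced_period (sel ?K r) ?k"
    using \<open>?k > 0\<close> per' kc by (simp add: balanced_period_def)
  then have "balanced_period (compress U D r) ?k"
    using balanced_period_as_rotor_type[OF range_sel[OF two]]
      compress_eq[OF two inf] by simp
  then show ?thesis by (rule that)
qed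

locale balanced_sequence =
  fixes r :: "nat \<Rightarrow> nat" and k :: nat
  assumes two: "range r \<subseteq> {1, 2}"
    and bal: "balanced_period r k"
begin

lemma k_pos: "k > 0"
  and period: "\<forall>i. r (i + 2 * k) = r i"
  and occ_k: "occ r 1 (2 * k) = k" "occ r 2 (2 * k) = k"
  using bal by (simp_all add: balanced_period_def)

lemma occ_two_periods: "occ r 1 (4 * k) = 2 * k" "occ r 2 (4 * k) = 2 * k"
  using occ_mult_period[OF period, of _ 2] occ_k by simp_all

text \<open>In two periods of the source rotor, vertices 2 and 3 are visited \<open>2 * k\<close>
  times each, a full period of their rotors.\<close>

sublocale rotor_cycle r "2 * k" "4 * k"
  by unfold_locales (use two period occ_two_periods in auto)

lemma keep_cases: "compressor_keep X Y a = 1 \<or> compressor_keep X Y a = 2"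
  unfolding compressor_keep_def by (cases "if a = 1 then X else Y") auto

lemma occ_keep: "occ r (compressor_keep X Y a) (2 * k) = k"
  using keep_cases[of X Y a] occ_k by auto

lemma kept_count_cycle: "kept_count (compressor_keep X Y) r (4 * k) = 2 * k"
  unfolding kept_count_eq occ_two_periods occ_keep by simp

lemma inf: "infinite {j. kept (compressor_keep X Y) r j}"
  by (rule infinite_kept) (simp add: kept_count_cycle k_pos)

lemmas compress_sel = compress_eq[OF two inf]

text \<open>During a cycle of \<open>4 * k\<close> departures each of the vertices 2 and 3 lets
  through \<open>k\<close> of its \<open>2 * k\<close> visits, so the hits have period
  \<open>2 * k\<close> again.\<close>

lemma balanced_compress: "balanced_period (compress X Y r) k"
proof -
  have "occ (sel (compressor_keep X Y) r) a (2 * k) = k" if "a = 1 \<or> a = 2" for a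
    using occ_kept[OF inf, of X Y a "4 * k"] that occ_two_periods occ_keep
    by (auto simp: kept_count_cycle)
  moreover have "\<forall>i. sel (compressor_keep X Y) r (i + 2 * k) = sel (compressor_keep X Y) r i"
    using sel_period[of "compressor_keep X Y"] k_pos by (simp add: kept_count_cycle)
  ultimately have "balanced_period (sel (compressor_keep X Y) r) k"
    using k_pos by (simp add: balanced_period_def)
  then show ?thesis
    unfolding compress_sel by (rule balanced_period_as_rotor_type[OF range_sel[OF two]])
qed

section \<open>Balance points under the operations \<open>UU\<close> and \<open>DD\<close>\<close>

lemma occ_balance_point:
  assumes "c \<in> balance_points r"
  shows "occ r 1 (2 * c) = c" "occ r 2 (2 * c) = c"
  using assms occ_total[OF two, of "2 * c"] by (auto simp: balance_points_def)

text \<open>Advancing \<open>c\<close> by \<open>k\<close> adds one whole period to the prefix of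
  length \<open>2 * c\<close>.\<close>

lemma balance_points_period: "c + k \<in> balance_points r \<longleftrightarrow> c \<in> balance_points r"
  using occ_add_period[OF period, of 1 "2 * c"] occ_k by (simp add: balance_points_def)

lemma balance_points_period_mult: "c + m * (2 * k) \<in> balance_points r \<longleftrightarrow> c \<in> balance_points r"
proof (induction m)
  case (Suc m)
  have "c + Suc m * (2 * k) = (c + m * (2 * k)) + k + k" by simp
  with Suc show ?case by (simp only: balance_points_period)
qed simp

lemma zero_balance_point: "0 \<in> balance_points r"
  by (simp add: balance_points_def)

text \<open>A balanced prefix of length \<open>2 * c\<close> holds the first \<open>c\<close>
  occurrences of each state, whose survival is decided by the first \<open>c\<close> terms of
  \<open>r\<close>.\<close>

lemma occ_sel_balance_point:
  assumes "c \<in> balance_points r"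
  shows "kept_count K r (2 * c) = occ r (K 1) c + occ r (K 2) c"
    and "a = 1 \<or> a = 2 \<Longrightarrow> occ (sel (compressor_keep X Y) r) a (kept_count (compressor_keep X Y) r (2 * c)) =
      occ r (compressor_keep X Y a) c"
  using occ_kept[OF inf, of X Y a "2 * c"] occ_balance_point[OF assms]
  by (auto simp: kept_count_eq)

text \<open>With equal variants, occurrences of 1 and 2 of the same rank survive or vanish together,
  so a balanced prefix leaves a balanced one.\<close>

lemma balance_points_compress_same:
  assumes "c \<in> balance_points r"
  shows "occ r (letter X) c \<in> balance_points (compress X X r)"
proof -
  have K: "compressor_keep X X = (\<lambda>a. letter X)"
    by (simp add: compressor_keep_def fun_eq_iff)
  have "occ r (letter X) c \<in> balance_points (sel (compressor_keep X X) r)"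
    using occ_sel_balance_point(2)[OF assms, of 1 X X]
      occ_sel_balance_point(1)[OF assms, of "compressor_keep X X"]
    by (simp add: K balance_points_def flip: mult_2)
  then show ?thesis
    by (simp add: compress_sel balance_points_as_rotor_type[OF range_sel[OF two]])
qed

definition num_points :: "nat" where
  "num_points = card (balance_points r \<inter> {..k})"

text \<open>The points up to \<open>2 * k\<close> are those up to \<open>k\<close> and their shifts
  by \<open>k\<close>; the two sets share only \<open>k\<close>.\<close>

lemma card_balance_points_double: "card (balance_points r \<inter> {..2 * k}) + 1 = 2 * num_points"
proof -
  let ?A = "balance_points r \<inter> {..k}"
  let ?B = "(\<lambda>c. c + k) ` ?A"
  have "balance_points r \<inter> {..2 * k} = ?A \<union> ?B"
  proof (intro set_eqI iffI)
    fix x assume x: "x \<in> balance_points r \<inter> {..2 * k}"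
    show "x \<in> ?A \<union> ?B"
    proof (cases "x \<le> k")
      case False
      then have "x = (x - k) + k" "x - k \<le> k" using x by auto
      moreover have "x - k \<in> balance_points r"
        using x calculation balance_points_period[of "x - k"] by simp
      ultimately show ?thesis by blast
    qed (use x in auto)
  qed (auto simp: balance_points_period)
  moreover have "?A \<inter> ?B = {k}"
    using zero_balance_point balance_points_period[of 0] by (auto simp: image_iff intro!: bexI[of _ 0])
  moreover have "card ?B = card ?A" by (simp add: card_image inj_on_def)
  ultimately show ?thesis
    using card_Un_Int[of ?A ?B] by (simp add: num_points_def)
qed

end

text \<open>Each of the \<open>card Z - 1\<close> steps along \<open>Z\<close> adds a new value to
  at least one image, and both images start with one value.\<close>

lemma card_image_chain:
  fixes W V :: "nat \<Rightarrow> nat"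
  assumes "finite Z" "Z \<noteq> {}" "mono W" "mono V"
    and "\<And>p q. p < q \<Longrightarrow> W p < W q \<or> V p < V q"
  shows "card Z + 1 \<le> card (W ` Z) + card (V ` Z)"
  using assms(1,2)
proof (induction Z rule: finite_linorder_max_induct)
  case (insert b A)
  show ?case
  proof (cases "A = {}")
    case False
    have new: "f b \<notin> f ` A" if "mono f" "f (Max A) < f b" for f :: "nat \<Rightarrow> nat"
    proof
      assume "f b \<in> f ` A"
      then obtain x where "x \<in> A" "f b = f x" by blast
      moreover have "f x \<le> f (Max A)"
        using \<open>x \<in> A\<close> insert.hyps(1) that(1) by (simp add: monoD)
      ultimately show False using that(2) by simp
    qed
    have "Max A < b" using insert.hyps False by simp
    from assms(5)[OF this] show ?thesis
      using new[OF assms(3)] new[OF assms(4)] insert False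
      by (auto simp: card_insert_if)
  qed simp
qed simp

context balanced_sequence
begin

lemma occ_letters_less: "p < q \<Longrightarrow> occ r 2 p < occ r 2 q \<or> occ r 1 p < occ r 1 q"
  using occ_total[OF two, of p] occ_total[OF two, of q] by linarith

text \<open>The points up to \<open>2 * k\<close> describe a cycle of \<open>4 * k\<close>
  departures, whose \<open>2 * k\<close> hits contain the balanced prefixes of half-length up to
  \<open>k\<close>.\<close>

lemma card_image_balance_points:
  "card (occ r (letter X) ` (balance_points r \<inter> {..2 * k})) \<le>
    card (balance_points (compress X X r) \<inter> {..k})"
proof (rule card_mono)
  have "occ r (letter X) (2 * k) = k" by (cases X) (simp_all add: occ_k)
  then show "occ r (letter X) ` (balance_points r \<inter> {..2 * k}) \<subseteq>
      balance_points (compress X X r) \<inter> {..k}"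
    using balance_points_compress_same occ_mono[of _ "2 * k" r "letter X"] by fastforce
qed simp

text \<open>The chain bound on the points up to \<open>2 * k\<close> gives the weak inequality. If
  the state changes away from a balance point, the chain splits there into two with disjoint images,
  and adding their bounds gains 1.\<close>

lemma num_points_compress:
  "2 * num_points \<le> card (balance_points (compress U U r) \<inter> {..k}) +
     card (balance_points (compress D D r) \<inter> {..k})" (is ?weak)
  and num_points_compress_strict: "\<not> cut_compatible r \<Longrightarrow>
   2 * num_points < card (balance_points (compress U U r) \<inter> {..k}) +
     card (balance_points (compress D D r) \<inter> {..k})" (is "_ \<Longrightarrow> ?strict")
proof -
  let ?Z = "balance_points r \<inter> {..2 * k}"
  have chain: "card Z + 1 \<le> card (occ r 2 ` Z) + card (occ r 1 ` Z)" if "Z \<subseteq> ?Z" "Z \<noteq> {}" for Z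
  proof (rule card_image_chain)
    show "finite Z" using finite_subset[OF that(1)] by simp
  qed (use that occ_letters_less in \<open>auto simp: mono_def occ_mono\<close>)
  have ends: "0 \<in> ?Z" "2 * k \<in> ?Z"
    using zero_balance_point balance_points_period_mult[of 0 1] by auto
  note upper = card_image_balance_points[of U] card_image_balance_points[of D]
  show ?weak
    using chain[OF subset_refl] ends upper card_balance_points_double by fastforce
  show ?strict if incompatible: "\<not> cut_compatible r"
  proof -
    obtain i' where i': "r i' \<noteq> r (Suc i')" "Suc i' \<notin> balance_points r"
      using incompatible by (auto simp: cut_compatible_def)
    \<comment> \<open>Reduction modulo the period brings the change of state between the points 0
      and \<open>2 * k\<close>.\<close>
    define i where "i = i' mod (2 * k)"
    have split: "i' = i + (i' div (2 * k)) * (2 * k)"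
      by (simp only: i_def mod_div_mult_eq)
    have "i < 2 * k" using k_pos by (simp add: i_def)
    have i: "r i \<noteq> r (Suc i)" "Suc i \<notin> balance_points r"
      using i' period_mult[OF period, of i "i' div (2 * k)"]
        period_mult[OF period, of "Suc i" "i' div (2 * k)"]
        balance_points_period_mult[of "Suc i" "i' div (2 * k)"] split
      by (metis add_Suc)+
    let ?A = "?Z \<inter> {..i}" and ?B = "?Z \<inter> {Suc (Suc i)..}"
    have "Suc i \<noteq> 2 * k" using i(2) ends by auto
    with \<open>i < 2 * k\<close> have ne: "?A \<noteq> {}" "?B \<noteq> {}" using ends by auto
    have "x \<le> i \<or> Suc (Suc i) \<le> x" if "x \<in> ?Z" for x
    proof -
      have "x \<noteq> Suc i" using i(2) that by auto
      then show ?thesis by linarith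
    qed
    then have Z: "?Z = ?A \<union> ?B" by auto
    have disj: "occ r a ` ?A \<inter> occ r a ` ?B = {}" if "a = 1 \<or> a = 2" for a
    proof -
      \<comment> \<open>Positions \<open>i\<close> and \<open>Suc i\<close> carry both states, so
        either count grows across the gap.\<close>
      have "r i = 1 \<or> r i = 2" "r (Suc i) = 1 \<or> r (Suc i) = 2" using two by auto
      then have "occ r a i < occ r a (Suc (Suc i))" using that i(1) by auto
      then have "occ r a x < occ r a y" if "x \<le> i" "Suc (Suc i) \<le> y" for x y
        using occ_mono[OF that(1), of r a] occ_mono[OF that(2), of r a] by linarith
      then show ?thesis by fastforce
    qed
    have card_im: "card (occ r a ` ?Z) = card (occ r a ` ?A) + card (occ r a ` ?B)"
      if "a = 1 \<or> a = 2" for a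
      by (subst Z, subst image_Un, rule card_Un_disjoint) (use disj[OF that] in auto)
    have "card ?Z = card ?A + card ?B"
      by (subst Z, rule card_Un_disjoint) auto
    then show ?thesis
      using chain[OF _ ne(1)] chain[OF _ ne(2)] card_im[of 1] card_im[of 2] upper
        card_balance_points_double by fastforce
  qed
qed

text \<open>For \<open>X \<noteq> Y\<close>, \<open>?K\<close> is the identity or the swap of the
  states, and just \<open>c\<close> terms survive from a balanced prefix of length
  \<open>2 * c\<close>. A block on which \<open>r\<close> is constant thus yields a block at the
  same place, constant with value \<open>?K\<close> of the old one; relabeling undoes a
  swap.\<close>

lemma compress_cut_compatible:
  assumes "cut_compatible r" "r 0 = 1" "X \<noteq> Y"
  shows "compress X Y r = r"
proof -
  let ?K = "compressor_keep X Y"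
  let ?g = "sel ?K r"
  have K: "?K 1 = 1 \<and> ?K 2 = 2 \<or> ?K 1 = 2 \<and> ?K 2 = 1"
    using assms(3) by (cases X; cases Y) (auto simp: compressor_keep_def)
  have at_point: "occ ?g a c = occ r (?K a) c" if "c \<in> balance_points r" "a = 1 \<or> a = 2" for a c
  proof -
    have "kept_count ?K r (2 * c) = c"
      using occ_sel_balance_point(1)[OF that(1), of ?K] K occ_total[OF two, of c] by auto
    then show ?thesis using occ_sel_balance_point(2)[OF that, of X Y] by simp
  qed
  have g: "?g m = ?K (r m)" for m
  proof -
    let ?P = "\<lambda>c. c \<in> balance_points r"
    define c where "c = Max (balance_points r \<inter> {..m})"
    define c' where "c' = (LEAST c. ?P c \<and> m < c)"
    have "c \<in> balance_points r \<inter> {..m}"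
      unfolding c_def by (rule Max_in) (use zero_balance_point in auto)
    \<comment> \<open>A multiple of the period serves as a balance point beyond \<open>m\<close>, so
      a next one exists.\<close>
    moreover have "Suc m * 1 \<le> Suc m * (2 * k)" by (rule mult_le_mono2) (use k_pos in simp)
    then have "?P (0 + Suc m * (2 * k)) \<and> m < 0 + Suc m * (2 * k)"
      unfolding balance_points_period_mult using zero_balance_point by simp
    then have "?P c' \<and> m < c'" unfolding c'_def by (rule LeastI)
    ultimately have c: "?P c" "c \<le> m" "?P c'" "m < c'" by auto
    have between: "i \<notin> balance_points r" if "c < i" "i < c'" for i
    proof
      assume "i \<in> balance_points r"
      moreover have "m < i"
      proof (rule ccontr)
        assume "\<not> m < i"
        then have "i \<le> c"
          using Max_ge[of "balance_points r \<inter> {..m}" i] calculation by (simp add: c_def)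
        with that(1) show False by simp
      qed
      ultimately show False using that(2) not_less_Least[of i "\<lambda>c. ?P c \<and> m < c"] by (simp add: c'_def)
    qed
    have const: "r i = r c" if "c \<le> i" "i < c'" for i
      by (rule constant_between_balance_points[OF assms(1) between that])
    define d e where "d = c' - c" and "e = m - c"
    then have d: "c' = c + d" and e: "m = c + e" "e < d" using c by auto
    have "occ r (r c) (c + d) = occ r (r c) c + (if r c = r c then d else 0)"
      by (rule occ_add_const, rule const[unfolded d])
    then have "occ r (r c) (c + d) = occ r (r c) c + d" by simp
    moreover have "r c = 1 \<or> r c = 2" using two by auto
    moreover from this have "?K (r c) = 1 \<or> ?K (r c) = 2" "?K (?K (r c)) = r c" using K by auto
    \<comment> \<open>A gain of \<open>d\<close> occurrences in \<open>d\<close> positions leaves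
      room for no other state.\<close>
    ultimately have "occ ?g (?K (r c)) (c + d) = occ ?g (?K (r c)) c + d"
      using at_point[OF c(1)] at_point[OF c(3)] d by simp
    from occ_add_full[OF this] have "?g m = ?K (r c)" using e by simp
    moreover have "r m = r c" by (rule const[OF c(2,4)])
    ultimately show ?thesis by simp
  qed
  show ?thesis
  proof
    fix i
    have "r i = 1 \<or> r i = 2" using two by auto
    then show "compress X Y r i = r i"
      using K assms(2) by (auto simp: compress_sel as_rotor_type_def g)
  qed
qed

end

section \<open>Run decompositions from balance points\<close>

lemma count_list_map_upt:
  "m \<le> n \<Longrightarrow> occ r a m + count_list (map r [m..<n]) a = occ r a n"
  by (induction n rule: dec_induct) auto

text \<open>Induction along the balance points adds one run per gap to each list. For
  \<open>c = k\<close> the runs \<open>bs\<close> fill a period but \<open>us\<close> only half of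
  it; \<open>vs\<close> cuts the other half at the same points shifted by \<open>k\<close>.\<close>

lemma (in balanced_sequence) run_decompositions_upto:
  assumes comp: "cut_compatible r"
  shows "c \<in> balance_points r \<Longrightarrow>
    \<exists>bs us vs. concat bs = map r [0..<2 * c] \<and> concat us = map r [0..<c] \<and>
      concat vs = map r [k..<k + c] \<and>
      map length bs = map (\<lambda>u. 2 * length u) us \<and> map length vs = map length us \<and>
      [] \<notin> set bs \<union> set us \<union> set vs \<and>
      (\<forall>w\<in>set bs. balanced_run w) \<and> (\<forall>w\<in>set us \<union> set vs. uniform_run w)"
proof (induction c rule: less_induct)
  case (less c)
  show ?case
  proof (cases "c = 0")
    case True
    then show ?thesis by (intro exI[of _ "[]"]) simp
  next
    case False
    define p where "p = Max (balance_points r \<inter> {..<c})"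
    have "p \<in> balance_points r \<inter> {..<c}"
      unfolding p_def by (rule Max_in) (use zero_balance_point False in auto)
    then have p: "p \<in> balance_points r" "p < c" by auto
    have between: "i \<notin> balance_points r" if "p < i" "i < c" for i
      using Max_ge[of "balance_points r \<inter> {..<c}" i] that by (auto simp: p_def[symmetric])
    have between': "i \<notin> balance_points r" if "k + p < i" "i < k + c" for i
      using between[of "i - k"] balance_points_period[of "i - k"] that by auto
    from less.IH[OF p(2,1)] obtain bs us vs where IH:
      "concat bs = map r [0..<2 * p]" "concat us = map r [0..<p]" "concat vs = map r [k..<k + p]"
      "map length bs = map (\<lambda>u. 2 * length u) us" "map length vs = map length us"
      "[] \<notin> set bs \<union> set us \<union> set vs"
      "\<forall>w\<in>set bs. balanced_run w" "\<forall>w\<in>set us \<union> set vs. uniform_run w"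
      by blast
    have uniform: "uniform_run (map r [q..<q + (c - p)])"
      if no_point: "\<And>i. q < i \<Longrightarrow> i < q + (c - p) \<Longrightarrow> i \<notin> balance_points r" for q
    proof -
      have "r i = r q" if "q \<le> i" "i < q + (c - p)" for i
        by (rule constant_between_balance_points[OF comp no_point that])
      then show ?thesis by (auto simp: uniform_run_def)
    qed
    have "uniform_run (map r [p..<c])" "uniform_run (map r [k + p..<k + c])"
      using uniform[of p] uniform[of "k + p"] between between' p(2) by auto
    moreover have "balanced_run (map r [2 * p..<2 * c])"
      using count_list_map_upt[of "2 * p" "2 * c" r 1] count_list_map_upt[of "2 * p" "2 * c" r 2] p
        occ_balance_point[OF p(1)] occ_balance_point[OF less.prems]
      unfolding balanced_run_def by simp
    moreover have "map r [a..<b] @ map r [b..<d] = map r [a..<d]" if "a \<le> b" "b \<le> d" for a b d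
      using upt_add_eq_append[OF that(1), of "d - b"] that(2) by (simp flip: map_append)
    ultimately show ?thesis
      using IH p(2)
      by (intro exI[of _ "bs @ [map r [2 * p..<2 * c]]"] exI[of _ "us @ [map r [p..<c]]"]
          exI[of _ "vs @ [map r [k + p..<k + c]]"]) auto
  qed
qed

text \<open>\<open>us @ vs\<close> has twice as many runs as \<open>bs\<close>, but its lengths
  repeat after \<open>us\<close>, so the types agree as periodic sequences.\<close>

lemma BURD_if_cut_compatible:
  assumes "rotor_type r" "fund_period r = 2 * k" "balanced_period r k" "cut_compatible r"
  shows "BURD r"
proof -
  interpret balanced_sequence r k
    by unfold_locales (use assms in \<open>auto simp: rotor_type_def\<close>)
  have "k \<in> balance_points r" using balance_points_period[of 0] zero_balance_point by simp
  from run_decompositions_upto[OF assms(4) this] obtain bs us vs where dec: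
    "concat bs = map r [0..<2 * k]" "concat us = map r [0..<k]" "concat vs = map r [k..<k + k]"
    "map length bs = map (\<lambda>u. 2 * length u) us" "map length vs = map length us"
    "[] \<notin> set bs \<union> set us \<union> set vs"
    "\<forall>w\<in>set bs. balanced_run w" "\<forall>w\<in>set us \<union> set vs. uniform_run w"
    by blast
  have bal_r: "balanced_rotor r"
    using occ_k assms(2) by (simp add: balanced_rotor_def occ_def)
  have "concat (us @ vs) = map r [0..<2 * k]"
    using dec(2,3) upt_add_eq_append[of 0 k k] by (simp add: mult_2 flip: map_append)
  then have "URD r (us @ vs)"
    using dec assms(2) by (auto simp: URD_def run_decomposition_def)
  moreover have "BRD r bs"
    using dec assms(2) bal_r by (auto simp: BRD_def run_decomposition_def)
  moreover have "BRD_type bs = URD_type (us @ vs)"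
  proof
    fix i
    define m where "m = length us"
    have len: "length bs = m" "length vs = m"
      using dec(4,5)[THEN arg_cong[of _ _ length]] by (simp_all add: m_def)
    have bs: "length (bs ! j) = 2 * length (us ! j)" "length (vs ! j) = length (us ! j)"
      if "j < m" for j
      using dec(4,5)[THEN arg_cong[of _ _ "\<lambda>xs. xs ! j"]] that len by (simp_all add: m_def)
    have "m > 0" using dec(2) k_pos by (cases us) (auto simp: m_def)
    define j where "j = i mod (2 * m)"
    have "i mod m = j mod m" unfolding j_def by (simp add: mod_mod_cancel)
    moreover have "j < 2 * m" using \<open>m > 0\<close> by (simp add: j_def)
    ultimately have "i mod m = (if j < m then j else j - m)"
      by (simp add: mod_if not_less)
    then show "BRD_type bs i = URD_type (us @ vs) i"
      using \<open>j < 2 * m\<close> bs[of "i mod m"] len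
      by (cases "j < m")
        (simp_all add: BRD_type_def URD_type_def nth_append mult_2[symmetric] flip: j_def m_def)
  qed
  ultimately show ?thesis unfolding BURD_def using assms(1) bal_r by blast
qed

section \<open>Fixed cycles\<close>

text \<open>All elements are reachable from \<open>s\<close>, so a property stable under the
  operations spreads over the cycle.\<close>

lemma fixed_cycle_invariant:
  assumes C: "fixed_cycle C"
    and step: "\<And>r X Y. r \<in> C \<Longrightarrow> P r \<Longrightarrow> P (compress X Y r)"
    and "s \<in> C" "P s" "r \<in> C"
  shows "P r"
proof (cases "s = r")
  case False
  then have "compress_step\<^sup>*\<^sup>* s r" using assms by (simp add: fixed_cycle_def)
  then have "r \<in> C \<and> P r"
  proof (induction rule: rtranclp_induct)
    case (step y z)
    then show ?case using C assms(2) by (auto simp: compress_step_def fixed_cycle_def)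
  qed (use assms in simp)
  then show ?thesis by simp
qed (use assms in simp)

lemma fixed_cycle_balanced:
  assumes C: "fixed_cycle C" and "r\<^sub>0 \<in> C"
  obtains k where "\<And>r. r \<in> C \<Longrightarrow> fund_period r = 2 * k \<and> balanced_period r k"
proof -
  have rotor: "rotor_type r" and closed: "compress X Y r \<in> C" if "r \<in> C" for r X Y
    using C that by (auto simp: fixed_cycle_def)
  have two: "range r \<subseteq> {1, 2}" if "r \<in> C" for r
    using rotor[OF that] by (simp add: rotor_type_def)
  have step: "balanced_period (compress X Y r) k" if "r \<in> C" "balanced_period r k" for r X Y k
    by (rule balanced_sequence.balanced_compress) (unfold_locales, use two that in auto)
  have bal: "\<exists>k. balanced_period r k" if "r \<in> C" for r
  proof (rule fixed_cycle_invariant[OF C, of "\<lambda>r. \<exists>k. balanced_period r k"])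
    show "compress U D r \<in> C" by (rule closed[OF that])
    show "\<exists>k. balanced_period (compress U D r) k"
      using compress_U_D_balanced[OF rotor[OF that]] by blast
  qed (use step that in blast)+
  \<comment> \<open>The half-period of \<open>s\<close> is preserved on the way to \<open>r\<close>;
    exchanging the two types then gives equal periods.\<close>
  have le: "fund_period r \<le> fund_period s" if r: "r \<in> C" and s: "s \<in> C" for r s
  proof -
    obtain k where k: "fund_period s = 2 * k" "balanced_period s k"
      using bal[OF s] fund_period_balanced[OF two[OF s]] by metis
    have "balanced_period r k"
      by (rule fixed_cycle_invariant[OF C, of "\<lambda>r. balanced_period r k" s]) (use step s k r in auto)
    then show ?thesis
      using fund_period_le[of "2 * k" r] k(1) by (simp add: balanced_period_def)
  qed
  obtain k where k: "fund_period r\<^sub>0 = 2 * k"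
    using bal[OF assms(2)] fund_period_balanced[OF two[OF assms(2)]] by metis
  show ?thesis
  proof (rule that)
    fix r assume "r \<in> C"
    obtain m where "fund_period r = 2 * m" "balanced_period r m"
      using bal[OF \<open>r \<in> C\<close>] fund_period_balanced[OF two[OF \<open>r \<in> C\<close>]] by metis
    moreover have "fund_period r = fund_period r\<^sub>0"
      using le[OF \<open>r \<in> C\<close> assms(2)] le[OF assms(2) \<open>r \<in> C\<close>] by simp
    ultimately show "fund_period r = 2 * k \<and> balanced_period r k" using k by simp
  qed
qed

theorem theorem7p12:
  fixes C :: "(nat \<Rightarrow> nat) set"
  assumes "fixed_cycle C"
  shows "\<forall>r\<in>C. BURD r"
proof
  fix r assume "r \<in> C"
  then obtain k where k: "\<And>r. r \<in> C \<Longrightarrow> fund_period r = 2 * k \<and> balanced_period r k"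
    using fixed_cycle_balanced[OF assms] by blast
  have rotor: "rotor_type r" and closed: "compress X Y r \<in> C" if "r \<in> C" for r X Y
    using assms that by (auto simp: fixed_cycle_def)
  have seq: "balanced_sequence r k" if "r \<in> C" for r
    using k[OF that] rotor[OF that] by unfold_locales (auto simp: rotor_type_def)
  define N where "N r = card (balance_points r \<inter> {..k})" for r
  have "N r \<le> card {..k}" for r unfolding N_def by (rule card_mono) auto
  then have "finite (N ` C)" by (intro finite_subset[of "N ` C" "{..card {..k}}"]) auto
  then obtain s where s: "s \<in> C" "N s = Max (N ` C)"
    using Max_in[of "N ` C"] \<open>r \<in> C\<close> by (metis empty_iff imageE image_is_empty)
  have max: "N r \<le> N s" if "r \<in> C" for r
    using \<open>finite (N ` C)\<close> that s(2) by simp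
  have maximal_compatible: "cut_compatible r"
    and maximal_compress: "N (compress U U r) = N s" "N (compress D D r) = N s"
    if "r \<in> C" "N r = N s" for r
  proof -
    note count = balanced_sequence.num_points_compress[OF seq[OF that(1)]]
      balanced_sequence.num_points_compress_strict[OF seq[OF that(1)]]
    note count = count[unfolded balanced_sequence.num_points_def[OF seq[OF that(1)]], folded N_def]
    have le: "N (compress U U r) \<le> N s" "N (compress D D r) \<le> N s"
      using max closed[OF that(1)] by simp_all
    \<comment> \<open>Two numbers bounded by \<open>N s\<close> cannot sum to more than
      \<open>2 * N s\<close>, and a sum of at least that forces both to equal
      \<open>N s\<close>.\<close>
    then show "cut_compatible r" using count(2) that(2) by linarith
    show "N (compress U U r) = N s" "N (compress D D r) = N s"
      using le count(1) that(2) by linarith+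
  qed
  have "N r = N s"
  proof (rule fixed_cycle_invariant[OF assms, of "\<lambda>r. N r = N s" s])
    fix r X Y assume r: "r \<in> C" "N r = N s"
    show "N (compress X Y r) = N s"
    proof (cases "X = Y")
      case True
      then show ?thesis using maximal_compress[OF r] by (cases Y) simp_all
    next
      case False
      have "r 0 = 1" using rotor[OF r(1)] by (simp add: rotor_type_def)
      with False have "compress X Y r = r"
        using balanced_sequence.compress_cut_compatible[OF seq[OF r(1)]] maximal_compatible[OF r]
        by blast
      then show ?thesis using r(2) by simp
    qed
  qed (use s \<open>r \<in> C\<close> in simp_all)
  then show "BURD r"
    using BURD_if_cut_compatible[OF rotor] k maximal_compatible \<open>r \<in> C\<close> by blast
qed

end
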